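(* Let $g$ be an escape metric on $\mathbb{R}^n$ (with associated constants $r_c>0$, $0<\rho_c\le 1$ and function $\alpha$) such that $$ r\,\alpha(x)+1\ge \rho_0,\qquad |x|\ge r_c, $$ where $\rho_0$ is a positive constant with $\rho_0\le \rho_c$. Let $$ c_0=\sup_{|x|\le r_c} r\,|Dr|_g(x). $$ Then, for any $x\in\mathbb{R}^n$ and any unit-speed geodesic $\gamma(t)$ of $(\mathbb{R}^n,g)$ starting at $x$, there exists $c(x)>0$ such that $$ |\gamma(t)|\ge \rho_0 t-\max\{|x|,c_0\},\qquad \forall t>c(x), $$ which implies $$ \lim_{t\to+\infty}|\gamma(t)|=+\infty. $$
   Context: Setting. Let $n\ge 2$, $r=r(x)=|x|$ the Euclidean norm, $\langle\cdot,\cdot\rangle$ the standard inner product, $\partial/\partial r=x/|x|$ for $x\neq 0$; for a matrix-valued function $G$, $\partial G/\partial r$ is the entrywise radial derivative in Cartesian coordinates. $(\mathbb{R}^n,g)$ is a smooth complete Riemannian manifold, $g=\sum g_{ij}(x)dx_idx_j$, $G(x)=(g_{ij}(x))$, and there is a constant $r_c>0$ with $G(x)\frac{\partial}{\partial r}=\frac{\partial}{\partial r}$ for $|x|\ge r_c$. Write $\langle X,Y\rangle_g=\langle G(x)X,Y\rangle$, $|X|_g^2=\langle X,X\rangle_g$ for $X,Y$ in the tangent space $\mathbb{R}^n_x$. $S(r)$ is the Euclidean sphere of radius $r$ centred at the origin and $S(r)_x$ its tangent space at $x$ (with $|x|=r$). $D$ is the Levi-Civita connection of $g$; for a function $f$,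 $Df$ is its $g$-gradient and $D^2f$ its Hessian in the metric $g$ (at the origin $r\,Dr$ is understood as $\frac12 D(r^2)$). Definition. $g$ is an escape metric if (i) $\left\langle \left(\frac12\frac{\partial G(x)}{\partial r}\right)X,X\right\rangle\ge \alpha(x)|X|_g^2$ for $X\in S(r)_x$, $|x|\ge r_c$; (ii) $D^2r^2(X,X)\ge 2\rho_c|X|_g^2$ for $X\in\mathbb{R}^n_x$, $|x|<r_c$; where $\rho_c\le 1$ is a positive constant and $\alpha$ is a smooth function on $|x|\ge r_c$ satisfying $\alpha(x)>-\frac1r$ for $|x|\ge r_c$. The notation $c(x)$ denotes a constant depending on $x$ (and not on the direction of the geodesic). *)

theory Defs
  imports "HOL-Analysis.Analysis"
begin

subsection \<open>Smooth maps\<close>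

text \<open>\<open>Ck_on k U f\<close> is the \<open>C\<^sup>k\<close> property; it is intended for open \<open>U\<close> only, since the
  derivatives are taken in the full space.\<close>

primrec Ck_on ::
  "nat \<Rightarrow> 'a::euclidean_space set \<Rightarrow> ('a \<Rightarrow> 'b::real_normed_vector) \<Rightarrow> bool" where
  "Ck_on 0 U f \<longleftrightarrow> continuous_on U f"
| "Ck_on (Suc k) U f \<longleftrightarrow>
     (\<forall>x\<in>U. f differentiable (at x)) \<and>
     (\<forall>v. Ck_on k U (\<lambda>x. frechet_derivative f (at x) v))"

text \<open>On a set that need not be open, smooth means: restriction of a smooth map defined on an
  open neighbourhood.\<close>

definition smooth_on ::
  "'a::euclidean_space set \<Rightarrow> ('a \<Rightarrow> 'b::real_normed_vector) \<Rightarrow> bool" where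
  "smooth_on A f \<longleftrightarrow>
     (\<exists>U h. open U \<and> A \<subseteq> U \<and> (\<forall>k. Ck_on k U h) \<and> (\<forall>x\<in>A. h x = f x))"


subsection \<open>Riemannian metrics on Euclidean space in Cartesian coordinates\<close>

type_synonym 'n metric = "real^'n \<Rightarrow> real^'n^'n"

definition riemannian_metric :: "('n::finite) metric \<Rightarrow> bool" where
  "riemannian_metric G \<longleftrightarrow>
     smooth_on UNIV G \<and>
     (\<forall>x. transpose (G x) = G x) \<and>
     (\<forall>x X. X \<noteq> 0 \<longrightarrow> (G x *v X) \<bullet> X > 0)"

definition g_inner :: "('n::finite) metric \<Rightarrow> real^'n \<Rightarrow> real^'n \<Rightarrow> real^'n \<Rightarrow> real" where
  "g_inner G x X Y = (G x *v X) \<bullet> Y"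

definition g_norm :: "('n::finite) metric \<Rightarrow> real^'n \<Rightarrow> real^'n \<Rightarrow> real" where
  "g_norm G x X = sqrt (g_inner G x X X)"

definition partial :: "'n \<Rightarrow> (real^'n \<Rightarrow> 'b::real_normed_vector) \<Rightarrow> real^('n::finite) \<Rightarrow> 'b" where
  "partial i f x = frechet_derivative f (at x) (axis i 1)"

text \<open>\<open>christoffel G x k i j\<close> is \<open>\<Gamma>\<^sup>k\<^sub>i\<^sub>j\<close> of the Levi-Civita connection at \<open>x\<close>.\<close>

definition christoffel :: "('n::finite) metric \<Rightarrow> real^'n \<Rightarrow> 'n \<Rightarrow> 'n \<Rightarrow> 'n \<Rightarrow> real" where
  "christoffel G x k i j =
     (1/2) * (\<Sum>l\<in>UNIV. matrix_inv (G x) $ k $ l *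
        (partial i (\<lambda>y. G y $ j $ l) x + partial j (\<lambda>y. G y $ i $ l) x
         - partial l (\<lambda>y. G y $ i $ j) x))"

definition christoffel_vec :: "('n::finite) metric \<Rightarrow> real^'n \<Rightarrow> real^'n \<Rightarrow> real^'n \<Rightarrow> real^'n" where
  "christoffel_vec G x X Y =
     (\<chi> k. \<Sum>i\<in>UNIV. \<Sum>j\<in>UNIV. christoffel G x k i j * X $ i * Y $ j)"

text \<open>\<open>(D\<^sub>X V)(x)\<close> for a tangent vector \<open>X\<close> at \<open>x\<close> and a vector field \<open>V\<close>.\<close>

definition levi_civita ::
  "('n::finite) metric \<Rightarrow> real^'n \<Rightarrow> real^'n \<Rightarrow> (real^'n \<Rightarrow> real^'n) \<Rightarrow> real^'n" where
  "levi_civita G x X V = frechet_derivative V (at x) X + christoffel_vec G x X (V x)"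

definition g_grad :: "('n::finite) metric \<Rightarrow> (real^'n \<Rightarrow> real) \<Rightarrow> real^'n \<Rightarrow> real^'n" where
  "g_grad G f x = matrix_inv (G x) *v (\<chi> i. partial i f x)"

text \<open>\<open>D\<^sup>2f(X,Y) = X(Yf) - (D\<^sub>X Y)f\<close>, a tensor in \<open>X\<close> and \<open>Y\<close>; the tangent vector \<open>Y\<close> at \<open>x\<close>
  is extended to the constant vector field.\<close>

definition g_hessian ::
  "('n::finite) metric \<Rightarrow> (real^'n \<Rightarrow> real) \<Rightarrow> real^'n \<Rightarrow> real^'n \<Rightarrow> real^'n \<Rightarrow> real" where
  "g_hessian G f x X Y =
     frechet_derivative (\<lambda>y. frechet_derivative f (at y) Y) (at x) X
     - frechet_derivative f (at x) (levi_civita G x X (\<lambda>_. Y))"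


subsection \<open>Geodesics and completeness\<close>

definition velocity :: "real set \<Rightarrow> (real \<Rightarrow> real^'n::finite) \<Rightarrow> real \<Rightarrow> real^'n" where
  "velocity I \<gamma> t = vector_derivative \<gamma> (at t within I)"

text \<open>\<open>D\<^bsub>\<gamma>'\<^esub>\<gamma>' = 0\<close> on an interval \<open>I\<close> (one-sided derivatives at end points contained in \<open>I\<close>).\<close>

definition geodesic_on :: "('n::finite) metric \<Rightarrow> real set \<Rightarrow> (real \<Rightarrow> real^'n) \<Rightarrow> bool" where
  "geodesic_on G I \<gamma> \<longleftrightarrow>
     (\<forall>t\<in>I. \<gamma> differentiable (at t within I) \<and>
        velocity I \<gamma> differentiable (at t within I) \<and>
        vector_derivative (velocity I \<gamma>) (at t within I)
          + christoffel_vec G (\<gamma> t) (velocity I \<gamma> t) (velocity I \<gamma> t) = 0)"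

definition unit_speed_on :: "('n::finite) metric \<Rightarrow> real set \<Rightarrow> (real \<Rightarrow> real^'n) \<Rightarrow> bool" where
  "unit_speed_on G I \<gamma> \<longleftrightarrow> (\<forall>t\<in>I. g_norm G (\<gamma> t) (velocity I \<gamma> t) = 1)"

text \<open>Geodesic completeness: the exponential map is defined on the whole tangent bundle.\<close>

definition complete_metric :: "('n::finite) metric \<Rightarrow> bool" where
  "complete_metric G \<longleftrightarrow>
     (\<forall>x v. \<exists>\<gamma>. geodesic_on G UNIV \<gamma> \<and> \<gamma> 0 = x \<and> velocity UNIV \<gamma> 0 = v)"


subsection \<open>Escape metrics\<close>

definition radial_vec :: "real^'n::finite \<Rightarrow> real^'n" where
  "radial_vec x = x /\<^sub>R norm x"

definition radial_deriv :: "('n::finite) metric \<Rightarrow> real^'n \<Rightarrow> real^'n^'n" where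
  "radial_deriv G x =
     (\<chi> i j. frechet_derivative (\<lambda>y. G y $ i $ j) (at x) (radial_vec x))"

definition sphere_tangent :: "real^'n::finite \<Rightarrow> (real^'n) set" where
  "sphere_tangent x = {X. X \<bullet> x = 0}"

definition escape_metric ::
  "('n::finite) metric \<Rightarrow> real \<Rightarrow> real \<Rightarrow> (real^'n \<Rightarrow> real) \<Rightarrow> bool" where
  "escape_metric G r\<^sub>c \<rho>\<^sub>c \<alpha> \<longleftrightarrow>
     0 < \<rho>\<^sub>c \<and> \<rho>\<^sub>c \<le> 1 \<and>
     smooth_on {x. norm x \<ge> r\<^sub>c} \<alpha> \<and>
     (\<forall>x. norm x \<ge> r\<^sub>c \<longrightarrow> \<alpha> x > - (1 / norm x)) \<and>
     (\<forall>x X. norm x \<ge> r\<^sub>c \<longrightarrow> X \<in> sphere_tangent x \<longrightarrow>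
        (((1/2) *\<^sub>R radial_deriv G x) *v X) \<bullet> X \<ge> \<alpha> x * (g_norm G x X)\<^sup>2) \<and>
     (\<forall>x X. norm x < r\<^sub>c \<longrightarrow>
        g_hessian G (\<lambda>y. (norm y)\<^sup>2) x X X \<ge> 2 * \<rho>\<^sub>c * (g_norm G x X)\<^sup>2)"

text \<open>\<open>r Dr\<close>, with the value \<open>D(r\<^sup>2)/2\<close> at the origin, where \<open>r\<close> is not differentiable.\<close>

definition r_grad_r :: "('n::finite) metric \<Rightarrow> real^'n \<Rightarrow> real^'n" where
  "r_grad_r G x =
     (if x = 0 then (1/2) *\<^sub>R g_grad G (\<lambda>y. (norm y)\<^sup>2) 0 else norm x *\<^sub>R g_grad G norm x)"

end

theory Submission
  imports Defs
begin

text \<open>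
  The proof studies \<open>f(t) = |\<gamma>(t)|\<^sup>2\<close> along the geodesic. Its second derivative is
  \<open>D\<^sup>2r\<^sup>2(\<gamma>', \<gamma>')\<close>, and the escape condition makes this at least \<open>2\<rho>\<^sub>0\<close> at every point of space.
  Inside the ball of radius \<open>r\<^sub>c\<close> this is part of the definition. Outside it, differentiating
  \<open>G(y) y = y\<close> shows that \<open>D\<^sup>2r\<^sup>2(X, X)\<close> equals \<open>2|X|\<^sub>g\<^sup>2 + r \<langle>(\<partial>G/\<partial>r) X, X\<rangle>\<close>, where only the part of \<open>X\<close>
  tangent to the sphere contributes to the second term
  (\<open>radial_fixed_derivative\<close>, \<open>hessian_norm_sq_ge_of_sphere_bound\<close>).

  Integrating twice gives \<open>f(t) \<ge> |x|\<^sup>2 + f'(0) t + \<rho>\<^sub>0 t\<^sup>2\<close>. Since \<open>f'(0) = 2\<langle>r Dr, \<gamma>'(0)\<rangle>\<^sub>g\<close>, the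
  Cauchy-Schwarz inequality gives \<open>f'(0) \<ge> -2b\<close> with \<open>b = r|Dr|\<^sub>g(x)\<close>, a number that does not depend
  on the direction of \<open>\<gamma>\<close>. It remains to compare \<open>|x|\<^sup>2 - 2bt + \<rho>\<^sub>0t\<^sup>2\<close> with \<open>(\<rho>\<^sub>0t - m)\<^sup>2\<close>
  for large \<open>t\<close>. If \<open>\<rho>\<^sub>0 = 1\<close> the quadratic terms cancel, so \<open>b \<le> m\<close> alone does not suffice: one needs
  \<open>b < m\<close>, or else \<open>b = m = |x|\<close> (\<open>escape_estimate\<close>). The second alternative holds
  for \<open>|x| \<ge> r\<^sub>c\<close>, where \<open>r Dr = x\<close>. The first holds with \<open>m = c\<^sub>0\<close> for \<open>|x| < r\<^sub>c\<close>: a function with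
  positive definite Hessian has a gradient whose length strictly increases in the direction of the
  gradient, so \<open>r|Dr|\<^sub>g\<close> cannot reach its supremum over the ball at an interior point
  (\<open>radial_gradient_norm_less_Sup\<close>).
\<close>

section \<open>Matrix-valued functions and symmetric matrices\<close>

lemma smooth_on_UNIV_differentiable:
  fixes f :: "'a::euclidean_space \<Rightarrow> 'b::real_normed_vector"
  assumes "smooth_on UNIV f"
  shows "f differentiable (at x)"
proof -
  obtain U h where U: "UNIV \<subseteq> U" "\<And>k. Ck_on k U h" "\<And>x. h x = f x"
    using assms unfolding smooth_on_def by auto
  have "h = f" using U(3) by auto
  with U(1) U(2)[of "Suc 0"] show ?thesis by auto
qed

lemma has_derivative_entry:
  assumes "(G has_derivative G') (at x)"
  shows "((\<lambda>y. G y $ i $ j) has_derivative (\<lambda>v. G' v $ i $ j)) (at x)"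
  using assms by (intro bounded_linear.has_derivative[OF bounded_linear_vec_nth])

lemma frechet_derivative_entry:
  assumes "(G has_derivative G') (at x)"
  shows "frechet_derivative (\<lambda>y. G y $ i $ j) (at x) v = G' v $ i $ j"
  using frechet_derivative_at[OF has_derivative_entry[OF assms]] by metis

lemma transpose_eq_self_iff: "transpose A = A \<longleftrightarrow> (\<forall>i j. A $ i $ j = A $ j $ i)"
  by (auto simp: transpose_def vec_eq_iff)

lemma symmetric_matrix_inner:
  fixes A :: "real^'n::finite^'n"
  assumes "transpose A = A"
  shows "(A *v X) \<bullet> Y = X \<bullet> (A *v Y)"
  using dot_lmul_matrix[of X A Y] transpose_matrix_vector[of A X] assms by simp

lemma linear_matrix_vector_mult_left: "linear (\<lambda>A :: real^'n::finite^'m::finite. A *v X)"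
  by (rule linearI) (simp_all add: matrix_vector_mult_add_rdistrib scaleR_matrix_vector_assoc[symmetric])

lemma invertible_if_positive:
  fixes A :: "real^'n::finite^'n"
  assumes "\<And>X. X \<noteq> 0 \<Longrightarrow> (A *v X) \<bullet> X > 0"
  shows "A ** matrix_inv A = mat 1" "matrix_inv A ** A = mat 1"
proof -
  have "X = 0" if "A *v X = 0" for X
    using assms[of X] that by (cases "X = 0") auto
  then have "invertible A"
    using invertible_left_inverse matrix_left_invertible_ker by blast
  then have "A ** matrix_inv A = mat 1 \<and> matrix_inv A ** A = mat 1"
    unfolding invertible_def matrix_inv_def by (rule someI_ex)
  then show "A ** matrix_inv A = mat 1" "matrix_inv A ** A = mat 1" by auto
qed

lemma transpose_derivative:
  assumes "(G has_derivative G') (at x)" "\<And>y. transpose (G y) = G y"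
  shows "transpose (G' v) = G' v"
proof -
  have "G' v $ i $ j = G' v $ j $ i" for i j
  proof -
    have "(\<lambda>y. G y $ i $ j) = (\<lambda>y. G y $ j $ i)"
      using assms(2) by (auto simp: transpose_eq_self_iff)
    then show ?thesis
      using frechet_derivative_entry[OF assms(1), of i j v]
        frechet_derivative_entry[OF assms(1), of j i v] by simp
  qed
  then show ?thesis by (simp add: transpose_eq_self_iff)
qed

section \<open>Christoffel symbols and the Hessian of the squared norm\<close>

text \<open>The Koszul formula with both lower arguments equal. Multiplying by \<open>G x\<close> removes the inverse matrix
  from the Christoffel symbols, and what remains depends on the derivative of \<open>G\<close> only.\<close>

lemma koszul_diagonal:
  fixes G :: "real^'n::finite \<Rightarrow> real^'n^'n"
  assumes G': "(G has_derivative G') (at x)"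
    and sym: "\<And>y. transpose (G y) = G y"
    and inv: "G x ** matrix_inv (G x) = mat 1"
  shows "(G x *v christoffel_vec G x X X) \<bullet> w = (G' X *v X) \<bullet> w - 1/2 * ((G' w *v X) \<bullet> X)"
proof -
  interpret G': bounded_linear G' using G' by (rule has_derivative_bounded_linear)
  define P where "P i = G' (axis i 1)" for i
  have G'_expand: "G' v $ j $ l = (\<Sum>i\<in>UNIV. P i $ j $ l * v $ i)" for v j l
  proof -
    have "v = (\<Sum>i\<in>UNIV. v $ i *\<^sub>R axis i 1)"
      by (metis (no_types, lifting) basis_expansion scalar_mult_eq_scaleR sum.cong)
    then have "G' v = (\<Sum>i\<in>UNIV. v $ i *\<^sub>R P i)"
      by (metis (no_types, lifting) G'.sum G'.scaleR P_def sum.cong)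
    then show ?thesis by (simp add: sum_component mult.commute)
  qed
  \<comment> \<open>\<open>K\<close> collects the Christoffel symbols of the first kind, contracted with \<open>X\<close> twice.\<close>
  define K where "K l = (\<Sum>i\<in>UNIV. \<Sum>j\<in>UNIV. 1/2 * (P i $ j $ l + P j $ i $ l - P l $ i $ j)
    * X $ i * X $ j)" for l
  have chr: "christoffel G x k i j = 1/2 * (\<Sum>l\<in>UNIV. matrix_inv (G x) $ k $ l *
     (P i $ j $ l + P j $ i $ l - P l $ i $ j))" for k i j
    by (simp add: christoffel_def partial_def frechet_derivative_entry[OF G'] P_def)
  have "christoffel_vec G x X X = matrix_inv (G x) *v (\<chi> l. K l)"
  proof -
    have "(\<Sum>i\<in>UNIV. \<Sum>j\<in>UNIV. christoffel G x k i j * X $ i * X $ j)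
      = (\<Sum>l\<in>UNIV. matrix_inv (G x) $ k $ l * K l)" for k
    proof -
      have "(\<Sum>i\<in>UNIV. \<Sum>j\<in>UNIV. christoffel G x k i j * X $ i * X $ j)
        = (\<Sum>i\<in>UNIV. \<Sum>j\<in>UNIV. \<Sum>l\<in>UNIV. matrix_inv (G x) $ k $ l *
            (1/2 * (P i $ j $ l + P j $ i $ l - P l $ i $ j) * X $ i * X $ j))"
        unfolding chr
        by (intro sum.cong refl) (simp add: sum_distrib_left sum_distrib_right algebra_simps)
      also have "\<dots> = (\<Sum>i\<in>UNIV. \<Sum>l\<in>UNIV. \<Sum>j\<in>UNIV. matrix_inv (G x) $ k $ l *
            (1/2 * (P i $ j $ l + P j $ i $ l - P l $ i $ j) * X $ i * X $ j))"
        by (intro sum.cong refl sum.swap)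
      also have "\<dots> = (\<Sum>l\<in>UNIV. \<Sum>i\<in>UNIV. \<Sum>j\<in>UNIV. matrix_inv (G x) $ k $ l *
            (1/2 * (P i $ j $ l + P j $ i $ l - P l $ i $ j) * X $ i * X $ j))"
        by (rule sum.swap)
      finally show ?thesis by (simp only: K_def sum_distrib_left)
    qed
    then show ?thesis
      by (simp add: christoffel_vec_def matrix_vector_mult_def vec_eq_iff)
  qed
  then have "G x *v christoffel_vec G x X X = (\<chi> l. K l)"
    by (simp add: matrix_vector_mul_assoc inv)
  moreover have "K l = (G' X *v X) $ l - 1/2 * ((P l *v X) \<bullet> X)" for l
  proof -
    have "transpose (P i) = P i" for i
      unfolding P_def by (rule transpose_derivative[OF G' sym])
    then have P_sym: "P i $ j $ l = P i $ l $ j" for i j l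
      by (simp add: transpose_eq_self_iff)
    have first: "(\<Sum>i\<in>UNIV. \<Sum>j\<in>UNIV. P i $ j $ l * X $ i * X $ j) = (G' X *v X) $ l"
    proof -
      have "(G' X *v X) $ l = (\<Sum>j\<in>UNIV. \<Sum>i\<in>UNIV. P i $ j $ l * X $ i * X $ j)"
        by (simp add: matrix_vector_mult_def G'_expand sum_distrib_right P_sym[of _ l])
      also have "\<dots> = (\<Sum>i\<in>UNIV. \<Sum>j\<in>UNIV. P i $ j $ l * X $ i * X $ j)"
        by (rule sum.swap)
      finally show ?thesis by simp
    qed
    have second: "(\<Sum>i\<in>UNIV. \<Sum>j\<in>UNIV. P j $ i $ l * X $ i * X $ j) = (G' X *v X) $ l"
      by (subst sum.swap) (simp add: first[symmetric] mult_ac)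
    have third: "(\<Sum>i\<in>UNIV. \<Sum>j\<in>UNIV. P l $ i $ j * X $ i * X $ j) = (P l *v X) \<bullet> X"
      by (simp add: inner_vec_def matrix_vector_mult_def sum_distrib_right sum_distrib_left mult_ac)
    have "K l = 1/2 * ((\<Sum>i\<in>UNIV. \<Sum>j\<in>UNIV. P i $ j $ l * X $ i * X $ j)
      + (\<Sum>i\<in>UNIV. \<Sum>j\<in>UNIV. P j $ i $ l * X $ i * X $ j)
      - (\<Sum>i\<in>UNIV. \<Sum>j\<in>UNIV. P l $ i $ j * X $ i * X $ j))"
      unfolding K_def by (simp add: sum_distrib_left algebra_simps sum.distrib sum_subtractf
        add_divide_distrib diff_divide_distrib)
    then show ?thesis unfolding first second third by (simp add: field_simps)
  qed
  moreover have "(G' w *v X) \<bullet> X = (\<Sum>l\<in>UNIV. ((P l *v X) \<bullet> X) * w $ l)"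
  proof -
    have "G' w = (\<Sum>l\<in>UNIV. w $ l *\<^sub>R P l)"
      by (simp add: vec_eq_iff G'_expand sum_component mult.commute)
    then have "G' w *v X = (\<Sum>l\<in>UNIV. w $ l *\<^sub>R (P l *v X))"
      using linear_sum[OF linear_matrix_vector_mult_left[of X], of "\<lambda>l. w $ l *\<^sub>R P l" UNIV]
      by (simp add: scaleR_matrix_vector_assoc[symmetric])
    then show ?thesis by (simp add: inner_sum_left mult.commute)
  qed
  ultimately show ?thesis
    by (simp add: inner_vec_def[of _ w] left_diff_distrib sum_subtractf sum_divide_distrib)
qed

lemma g_hessian_norm_sq:
  fixes G :: "real^'n::finite \<Rightarrow> real^'n^'n"
  shows
  "g_hessian G (\<lambda>y. (norm y)\<^sup>2) x X X = 2 * (X \<bullet> X - x \<bullet> christoffel_vec G x X X)"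
proof -
  have D: "frechet_derivative (\<lambda>y. (norm y)\<^sup>2) (at y) = (\<lambda>v. 2 * (y \<bullet> v))" for y :: "real^'n"
  proof -
    have "((\<lambda>y. (norm y)\<^sup>2) has_derivative (\<lambda>v. 2 * (y \<bullet> v))) (at y)"
      unfolding power2_norm_eq_inner by (auto intro!: derivative_eq_intros simp: inner_commute)
    then show ?thesis by (rule frechet_derivative_at[symmetric])
  qed
  have "((\<lambda>y. 2 * (y \<bullet> X)) has_derivative (\<lambda>v. 2 * (v \<bullet> X))) (at x)"
    by (auto intro!: derivative_eq_intros)
  then have "frechet_derivative (\<lambda>y. 2 * (y \<bullet> X)) (at x) X = 2 * (X \<bullet> X)"
    by (metis frechet_derivative_at)
  then show ?thesis
    by (simp add: g_hessian_def D levi_civita_def)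
qed

text \<open>Both branches of the definition are half the gradient of \<open>r\<^sup>2\<close>, whose Euclidean gradient is \<open>2x\<close>.\<close>

lemma r_grad_r_eq:
  fixes G :: "real^'n::finite \<Rightarrow> real^'n^'n"
  shows "r_grad_r G x = matrix_inv (G x) *v x"
proof (cases "x = 0")
  case True
  have "((\<lambda>y. (norm y)\<^sup>2) has_derivative (\<lambda>v. 0)) (at (0 :: real^'n))"
    unfolding power2_norm_eq_inner by (auto intro!: derivative_eq_intros)
  from frechet_derivative_at[OF this]
  have "partial i (\<lambda>y. (norm y)\<^sup>2) (0 :: real^'n) = 0" for i
    unfolding partial_def by metis
  then have "(\<chi> i. partial i (\<lambda>y. (norm y)\<^sup>2) (0 :: real^'n)) = 0"
    by (subst vec_eq_iff) simp
  then show ?thesis using True by (simp add: r_grad_r_def g_grad_def)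
next
  case False
  have "partial i norm x = x $ i / norm x" for i
  proof -
    have "(norm has_derivative (\<lambda>v. v \<bullet> sgn x)) (at x)"
      using has_derivative_norm[OF False] by (simp add: inner_commute)
    from frechet_derivative_at[OF this, symmetric]
    show ?thesis
      by (simp add: partial_def inner_axis' sgn_div_norm divide_inverse_commute)
  qed
  then have "(\<chi> i. partial i norm x) = (1 / norm x) *\<^sub>R x"
    by (subst vec_eq_iff) simp
  then show ?thesis using False by (simp add: r_grad_r_def g_grad_def matrix_vector_mult_scaleR)
qed

section \<open>The Hessian where the metric fixes the radial direction\<close>

lemma has_real_derivative_along_line:
  fixes G :: "real^'n::finite \<Rightarrow> real^'n^'n"
  assumes "(G has_derivative G') (at x)"
  shows "((\<lambda>s. (G (x + s *\<^sub>R v) *v a) \<bullet> b) has_real_derivative (G' v *v a) \<bullet> b) (at 0 within S)"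
proof -
  interpret G': bounded_linear G' using assms by (rule has_derivative_bounded_linear)
  have "bounded_linear (\<lambda>A :: real^'n^'n. (A *v a) \<bullet> b)"
    by (intro bounded_linear_inner_left_comp linear_conv_bounded_linear[THEN iffD1]
      linear_matrix_vector_mult_left)
  moreover have "((\<lambda>s. G (x + s *\<^sub>R v)) has_derivative (\<lambda>s. G' (s *\<^sub>R v))) (at 0 within S)"
    by (rule has_derivative_compose[of "\<lambda>s. x + s *\<^sub>R v"])
      (use assms in \<open>auto intro!: derivative_eq_intros\<close>)
  ultimately have "((\<lambda>s. (G (x + s *\<^sub>R v) *v a) \<bullet> b) has_derivative (\<lambda>s. (G' (s *\<^sub>R v) *v a) \<bullet> b))
      (at 0 within S)"
    by (rule bounded_linear.has_derivative)
  then show ?thesis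
    by (rule has_derivative_imp_has_field_derivative)
      (simp add: G'.scaleR scaleR_matrix_vector_assoc[symmetric])
qed

text \<open>Differentiate \<open>G(y) y = y\<close>. The identity is available only outside the open ball through \<open>x\<close>, but that
  region contains the half line from \<open>x\<close> in every direction \<open>v\<close> with \<open>x \<bullet> v \<ge> 0\<close>; a one-sided
  derivative along it is enough, and linearity in \<open>v\<close> covers the remaining directions.\<close>

lemma radial_fixed_derivative:
  fixes G :: "real^'n::finite \<Rightarrow> real^'n^'n"
  assumes G': "(G has_derivative G') (at x)"
    and fixed: "\<And>y. norm y \<ge> norm x \<Longrightarrow> G y *v y = y"
  shows "G' v *v x = v - G x *v v"
proof -
  interpret G': bounded_linear G' using G' by (rule has_derivative_bounded_linear)
  have outward: "G' v *v x = v - G x *v v" if "x \<bullet> v \<ge> 0" for v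
  proof -
    have "(G' v *v x) \<bullet> b + (G x *v v) \<bullet> b = v \<bullet> b" for b
    proof -
      have "norm (x + s *\<^sub>R v) \<ge> norm x" if "s \<ge> 0" for s
        using \<open>x \<bullet> v \<ge> 0\<close> that
        by (simp add: norm_le inner_add_left inner_add_right inner_commute[of v x])
      then have eq: "(G (x + s *\<^sub>R v) *v x) \<bullet> b + s * ((G (x + s *\<^sub>R v) *v v) \<bullet> b) = (x + s *\<^sub>R v) \<bullet> b"
        if "s \<in> {0..}" for s
        using fixed[of "x + s *\<^sub>R v"] that
        by (metis atLeast_iff inner_add_left inner_scaleR_left matrix_vector_mult_scaleR matrix_vector_right_distrib)
      have "((\<lambda>s. (G (x + s *\<^sub>R v) *v x) \<bullet> b + s * ((G (x + s *\<^sub>R v) *v v) \<bullet> b))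
          has_real_derivative (G' v *v x) \<bullet> b + (G x *v v) \<bullet> b) (at 0 within {0..})"
        by (rule derivative_eq_intros has_real_derivative_along_line[OF G'] refl)+ simp
      moreover have "((\<lambda>s. (x + s *\<^sub>R v) \<bullet> b) has_real_derivative v \<bullet> b) (at 0 within {0..})"
        by (simp add: inner_add_left) (auto intro!: derivative_eq_intros)
      then have "((\<lambda>s. (G (x + s *\<^sub>R v) *v x) \<bullet> b + s * ((G (x + s *\<^sub>R v) *v v) \<bullet> b))
          has_real_derivative v \<bullet> b) (at 0 within {0..})"
        by (rule has_field_derivative_transform_within[where d = 1]) (auto simp: eq)
      ultimately show ?thesis
        by (rule has_field_derivative_unique) (simp add: at_within_Ici_at_right)
    qed
    then show ?thesis
      by (metis add_diff_cancel_right' inner_add_left vector_eq_rdot)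
  qed
  show ?thesis
  proof (cases "x \<bullet> v \<ge> 0")
    case False
    then show ?thesis
      using outward[of "- v"]
        linear_neg[OF linear_matrix_vector_mult_left[of x], of "G' v"]
        linear_neg[OF matrix_vector_mul_linear[of "G x"], of v]
      by (simp add: G'.neg) (metis minus_diff_eq minus_minus)
  qed (rule outward)
qed

text \<open>Since \<open>G x\<close> fixes \<open>x\<close>, the Koszul formula evaluates \<open>x \<bullet> \<Gamma>(X, X)\<close>, and the previous
  lemma turns its first term into \<open>X \<bullet> X - |X|\<^sub>g\<^sup>2\<close>. This leaves \<open>2|X|\<^sub>g\<^sup>2 + (G' x X) \<bullet> X\<close> for the
  Hessian, where \<open>G' x\<close> is \<open>r\<close> times the radial derivative. Both forms split orthogonally along \<open>X = c x + Y\<close>: on the radial part the Hessian is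
  \<open>2|c x|\<^sub>g\<^sup>2\<close>, and on \<open>Y\<close> the sphere condition bounds it below by \<open>2(1 + r a)|Y|\<^sub>g\<^sup>2\<close>.\<close>

lemma hessian_norm_sq_ge_of_sphere_bound:
  fixes G :: "real^'n::finite \<Rightarrow> real^'n^'n"
  assumes G': "(G has_derivative G') (at x)"
    and sym: "\<And>y. transpose (G y) = G y"
    and pos: "\<And>X. X \<noteq> 0 \<Longrightarrow> (G x *v X) \<bullet> X > 0"
    and "x \<noteq> 0"
    and fixed: "\<And>y. norm y \<ge> norm x \<Longrightarrow> G y *v y = y"
    and sphere: "\<And>Y. Y \<bullet> x = 0 \<Longrightarrow>
      (((1/2) *\<^sub>R radial_deriv G x) *v Y) \<bullet> Y \<ge> a * ((G x *v Y) \<bullet> Y)"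
    and "norm x * a + 1 \<ge> \<rho>" "\<rho> \<le> 1"
  shows "g_hessian G (\<lambda>y. (norm y)\<^sup>2) x X X \<ge> 2 * \<rho> * ((G x *v X) \<bullet> X)"
proof -
  interpret G': bounded_linear G' using G' by (rule has_derivative_bounded_linear)
  note G'_sym = symmetric_matrix_inner[OF transpose_derivative[OF G' sym]]
  note G_sym = symmetric_matrix_inner[OF sym]
  note G'_x = radial_fixed_derivative[OF G' fixed]
  have Gx: "G x *v x = x" using fixed by simp
  have "x \<bullet> christoffel_vec G x X X = (G x *v christoffel_vec G x X X) \<bullet> x"
    using Gx G_sym by (metis inner_commute)
  also have "\<dots> = (G' X *v X) \<bullet> x - 1/2 * ((G' x *v X) \<bullet> X)"
    by (rule koszul_diagonal[OF G' sym invertible_if_positive(1)[OF pos]])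
  also have "(G' X *v X) \<bullet> x = X \<bullet> X - (G x *v X) \<bullet> X"
  proof -
    have "(G' X *v X) \<bullet> x = X \<bullet> (G' X *v x)" by (rule G'_sym)
    then show ?thesis by (simp add: G'_x inner_diff_right inner_commute)
  qed
  finally have hess: "g_hessian G (\<lambda>y. (norm y)\<^sup>2) x X X = 2 * ((G x *v X) \<bullet> X) + (G' x *v X) \<bullet> X"
    by (simp add: g_hessian_norm_sq)

  define c where "c = (X \<bullet> x) / (x \<bullet> x)"
  define Y where "Y = X - c *\<^sub>R x"
  have X: "X = c *\<^sub>R x + Y" by (simp add: Y_def)
  have Yx: "Y \<bullet> x = 0" using \<open>x \<noteq> 0\<close> by (simp add: Y_def c_def inner_diff_left)
  have "(G x *v Y) \<bullet> x = 0" using G_sym[of x Y x] Gx Yx by simp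
  then have gX: "(G x *v X) \<bullet> X = c\<^sup>2 * (x \<bullet> x) + (G x *v Y) \<bullet> Y"
    using Yx by (simp add: X matrix_vector_right_distrib matrix_vector_mult_scaleR Gx inner_add_left
      inner_add_right power2_eq_square inner_commute[of x Y])
  have G'xx: "G' x *v x = 0" using G'_x[of x] Gx by simp
  then have "(G' x *v Y) \<bullet> x = 0" using G'_sym[of x Y x] by simp
  then have G'X: "(G' x *v X) \<bullet> X = (G' x *v Y) \<bullet> Y"
    by (simp add: X matrix_vector_right_distrib matrix_vector_mult_scaleR G'xx inner_add_right)
  have "radial_deriv G x = G' (radial_vec x)"
    by (simp add: radial_deriv_def frechet_derivative_entry[OF G'] vec_eq_iff)
  then have "G' x = norm x *\<^sub>R radial_deriv G x"
    using \<open>x \<noteq> 0\<close> by (simp add: radial_vec_def G'.scaleR)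
  then have "(G' x *v Y) \<bullet> Y = norm x * (2 * ((((1/2) *\<^sub>R radial_deriv G x) *v Y) \<bullet> Y))"
    by (simp add: scaleR_matrix_vector_assoc[symmetric])
  also have "\<dots> \<ge> norm x * (2 * (a * ((G x *v Y) \<bullet> Y)))"
    using sphere[OF Yx] by (intro mult_left_mono) auto
  finally have "(G' x *v Y) \<bullet> Y \<ge> 2 * (norm x * a) * ((G x *v Y) \<bullet> Y)" by simp
  moreover have nn: "(G x *v Y) \<bullet> Y \<ge> 0" using pos[of Y] by (cases "Y = 0") auto
  have "(norm x * a + 1) * ((G x *v Y) \<bullet> Y) \<ge> \<rho> * ((G x *v Y) \<bullet> Y)"
    using nn assms(7) by (rule mult_right_mono[rotated])
  moreover have "c\<^sup>2 * (x \<bullet> x) \<ge> \<rho> * (c\<^sup>2 * (x \<bullet> x))"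
    using mult_right_mono[OF \<open>\<rho> \<le> 1\<close>, of "c\<^sup>2 * (x \<bullet> x)"] by simp
  ultimately show ?thesis
    unfolding hess gX G'X by (simp add: algebra_simps)
qed

section \<open>The length of the radial gradient inside the ball\<close>

lemma positive_form_uniform_on_compact:
  fixes G :: "'a::euclidean_space \<Rightarrow> real^'n::finite^'n"
  assumes "compact K" "continuous_on K G"
    and pos: "\<And>x X. X \<noteq> 0 \<Longrightarrow> (G x *v X) \<bullet> X > 0"
  obtains l where "l > 0" "\<And>x X. x \<in> K \<Longrightarrow> (G x *v X) \<bullet> X \<ge> l * (X \<bullet> X)"
proof (cases "K = {}")
  case True
  then show ?thesis using that[of 1] by simp
next
  case False
  let ?q = "\<lambda>p. (G (fst p) *v snd p) \<bullet> snd p"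
  let ?S = "K \<times> sphere (0 :: real^'n) 1"
  have "continuous_on ?S (\<lambda>p. G (fst p))"
    by (rule continuous_on_compose2[OF assms(2)]) (auto intro: continuous_intros)
  then have "continuous_on ?S ?q"
    unfolding inner_vec_def matrix_vector_mult_def by (auto intro!: continuous_intros)
  moreover have "?S \<noteq> {}" "compact ?S"
    using False assms(1) by (auto intro!: compact_Times)
  ultimately obtain p where p: "p \<in> ?S" "\<And>p'. p' \<in> ?S \<Longrightarrow> ?q p \<le> ?q p'"
    using continuous_attains_inf[of ?S ?q] by blast
  show ?thesis
  proof (rule that)
    show "?q p > 0" using p(1) by (intro pos) auto
    show "(G x *v X) \<bullet> X \<ge> ?q p * (X \<bullet> X)" if "x \<in> K" for x X
    proof (cases "X = 0")
      case X: False
      have "(x, X /\<^sub>R norm X) \<in> ?S" using that X by simp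
      from p(2)[OF this] have "?q p \<le> (G x *v X) \<bullet> X / (norm X)\<^sup>2"
        by (simp add: matrix_vector_mult_scaleR divide_inverse power2_eq_square mult_ac)
      then show ?thesis using X by (simp add: pos_le_divide_eq power2_norm_eq_inner)
    qed simp
  qed
qed

text \<open>With \<open>V = G(y)\<^sup>-\<^sup>1 y = r Dr\<close> the squared length of \<open>V\<close> is \<open>y \<bullet> V y\<close>, the maximum of
  \<open>2 w \<bullet> y - |w|\<^sub>g\<^sup>2\<close> over all \<open>w\<close>. Freezing \<open>w = V x\<close> while \<open>y\<close> moves from \<open>x\<close> in the direction
  \<open>V x\<close> gives a minorant \<open>\<psi>\<close> that is exact at \<open>x\<close> and whose derivative there is
  \<open>D\<^sup>2r\<^sup>2(V x, V x) > 0\<close>. So some nearby point of the ball has a longer gradient.\<close>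

lemma radial_gradient_norm_less_Sup:
  fixes G :: "real^'n::finite \<Rightarrow> real^'n^'n"
  assumes diff: "\<And>x. G differentiable (at x)"
    and sym: "\<And>y. transpose (G y) = G y"
    and pos: "\<And>x X. X \<noteq> 0 \<Longrightarrow> (G x *v X) \<bullet> X > 0"
    and hess: "\<And>x X. norm x < R \<Longrightarrow> X \<noteq> 0 \<Longrightarrow> g_hessian G (\<lambda>y. (norm y)\<^sup>2) x X X > 0"
    and x: "norm x < R"
  shows "g_norm G x (r_grad_r G x) < (SUP y\<in>cball 0 R. g_norm G y (r_grad_r G y))"
proof -
  define V where "V y = matrix_inv (G y) *v y" for y
  note G_sym = symmetric_matrix_inner[OF sym]
  have GV: "G y *v V y = y" for y
    using invertible_if_positive(1)[OF pos, of y] by (simp add: V_def matrix_vector_mul_assoc)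
  have eq: "g_norm G y (r_grad_r G y) = sqrt (y \<bullet> V y)" for y
    by (simp add: r_grad_r_eq V_def[symmetric] g_norm_def g_inner_def GV)
  \<comment> \<open>The variational bound is the positivity of \<open>|V y - w|\<^sub>g\<^sup>2\<close>.\<close>
  have test: "y \<bullet> V y \<ge> 2 * (w \<bullet> y) - (G y *v w) \<bullet> w" for y w
  proof -
    have "(G y *v (V y - w)) \<bullet> (V y - w) \<ge> 0"
      using pos[of "V y - w" y] by (cases "V y = w") auto
    moreover have "(G y *v w) \<bullet> V y = w \<bullet> y" using G_sym[of y w "V y"] GV by simp
    ultimately show ?thesis
      by (simp add: matrix_vector_mult_diff_distrib inner_diff_left inner_diff_right GV inner_commute)
  qed
  \<comment> \<open>The supremum of a real set is meaningful only once the set is bounded above.\<close>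
  have "continuous_on (cball 0 R) G"
    using diff by (intro continuous_at_imp_continuous_on ballI differentiable_imp_continuous_within)
  then obtain l where l: "l > 0" "\<And>y X. y \<in> cball 0 R \<Longrightarrow> (G y *v X) \<bullet> X \<ge> l * (X \<bullet> X)"
    using positive_form_uniform_on_compact[OF compact_cball, of 0 R G] pos by blast
  have "sqrt (y \<bullet> V y) \<le> sqrt (R * (R / l))" if "y \<in> cball 0 R" for y
  proof -
    have "l * (norm (V y) * norm (V y)) \<le> y \<bullet> V y"
      using l(2)[OF that, of "V y"] by (simp add: GV power2_norm_eq_inner[symmetric] power2_eq_square)
    also have "\<dots> \<le> norm y * norm (V y)" by (rule norm_cauchy_schwarz)
    finally have "l * norm (V y) \<le> norm y"
      by (cases "V y = 0") (auto simp: mult.assoc[symmetric] )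
    then have "norm (V y) \<le> R / l" using that l(1) by (simp add: field_simps)
    then have "norm y * norm (V y) \<le> R * (R / l)"
      using that order_trans[OF norm_ge_zero[of y], of R] by (intro mult_mono) auto
    then show ?thesis using norm_cauchy_schwarz[of y "V y"] by simp
  qed
  then have bdd: "bdd_above ((\<lambda>y. g_norm G y (r_grad_r G y)) ` cball 0 R)"
    unfolding eq by (intro bdd_aboveI2)
  have "\<exists>y\<in>cball 0 R. y \<bullet> V y > x \<bullet> V x"
  proof (cases "x = 0")
    case True
    have "R > 0" using x by (simp add: le_less_trans[OF norm_ge_zero])
    \<comment> \<open>The gradient vanishes at the origin, so any other point of the ball does better.\<close>
    obtain y :: "real^'n" where y: "norm y = R" using vector_choose_size[of R] \<open>R > 0\<close> by auto
    then have "y \<noteq> 0" using \<open>R > 0\<close> by auto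
    then have "V y \<noteq> 0" using GV[of y] by auto
    then have "y \<bullet> V y > 0" using pos[of "V y" y] GV by simp
    then show ?thesis using y True by (intro bexI[of _ y]) auto
  next
    case False
    then have Vx: "V x \<noteq> 0" using GV[of x] by auto
    obtain G' where G': "(G has_derivative G') (at x)" using diff by (auto simp: differentiable_def)
    define \<psi> where "\<psi> s = 2 * (V x \<bullet> (x + s *\<^sub>R V x)) - (G (x + s *\<^sub>R V x) *v V x) \<bullet> V x" for s
    have "(\<psi> has_real_derivative 2 * (V x \<bullet> V x) - (G' (V x) *v V x) \<bullet> V x) (at 0)"
      unfolding \<psi>_def inner_add_right inner_scaleR_right
      by (rule derivative_eq_intros has_real_derivative_along_line[OF G'] refl)+ simp
    moreover have "x \<bullet> christoffel_vec G x (V x) (V x) = 1/2 * ((G' (V x) *v V x) \<bullet> V x)"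
      using koszul_diagonal[OF G' sym invertible_if_positive(1)[OF pos], of "V x" "V x"]
        G_sym[of x "christoffel_vec G x (V x) (V x)" "V x"] by (simp add: GV inner_commute)
    then have "2 * (V x \<bullet> V x) - (G' (V x) *v V x) \<bullet> V x > 0"
      using hess[OF x Vx] by (simp add: g_hessian_norm_sq)
    ultimately obtain d where d: "d > 0" "\<And>h. 0 < h \<Longrightarrow> h < d \<Longrightarrow> \<psi> 0 < \<psi> h"
      using DERIV_pos_inc_right[of \<psi> _ 0] by (metis add_0)
    \<comment> \<open>The second bound keeps the new point inside the ball.\<close>
    define h where "h = min (d / 2) ((R - norm x) / norm (V x))"
    have h: "0 < h" "h < d" using d(1) x Vx by (auto simp: h_def)
    have "h * norm (V x) \<le> R - norm x" using Vx by (simp add: h_def min_def field_simps)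
    then have "norm (x + h *\<^sub>R V x) \<le> R"
      using norm_triangle_ineq[of x "h *\<^sub>R V x"] h(1) by simp
    moreover have "x \<bullet> V x = \<psi> 0"
      by (simp add: \<psi>_def GV inner_commute)
    then have "x \<bullet> V x < (x + h *\<^sub>R V x) \<bullet> V (x + h *\<^sub>R V x)"
      using d(2)[OF h] test[of "V x" "x + h *\<^sub>R V x"] by (simp add: \<psi>_def)
    ultimately show ?thesis by (intro bexI[of _ "x + h *\<^sub>R V x"]) auto
  qed
  then obtain y where y: "y \<in> cball 0 R" "y \<bullet> V y > x \<bullet> V x" by auto
  have "g_norm G x (r_grad_r G x) < g_norm G y (r_grad_r G y)"
    unfolding eq using y(2) by simp
  also have "\<dots> \<le> (SUP y\<in>cball 0 R. g_norm G y (r_grad_r G y))"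
    using bdd y(1) by (rule cSUP_upper[rotated])
  finally show ?thesis .
qed

section \<open>Growth along geodesics\<close>

lemma quadratic_lower_bound:
  fixes f f' f'' :: "real \<Rightarrow> real"
  assumes f: "\<And>t. t \<ge> 0 \<Longrightarrow> (f has_real_derivative f' t) (at t within {0..})"
    and f': "\<And>t. t \<ge> 0 \<Longrightarrow> (f' has_real_derivative f'' t) (at t within {0..})"
    and f'': "\<And>t. t \<ge> 0 \<Longrightarrow> f'' t \<ge> 2 * c"
    and "t \<ge> 0"
  shows "f t \<ge> f 0 + f' 0 * t + c * t\<^sup>2"
proof -
  have mono: "k 0 \<le> k t"
    if "t \<ge> 0" and k: "\<And>t. t \<ge> 0 \<Longrightarrow> (k has_real_derivative k' t) (at t within {0..})"
      and k': "\<And>t. t \<ge> 0 \<Longrightarrow> k' t \<ge> 0" for k k' :: "real \<Rightarrow> real" and t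
  proof (rule DERIV_nonneg_imp_increasing_open[OF \<open>t \<ge> 0\<close>])
    show "\<exists>y. (k has_real_derivative y) (at s) \<and> y \<ge> 0" if "0 < s" "s < t" for s
    proof -
      have "at s within {0..} = at s" using that by (intro at_within_interior) simp
      then show ?thesis using k[of s] k'[of s] that by auto
    qed
    have "continuous_on {0..} k"
      by (rule DERIV_continuous_on[of _ _ k']) (auto intro: k)
    then show "continuous_on {0..t} k" by (rule continuous_on_subset) auto
  qed
  have "f' t \<ge> f' 0 + 2 * c * t" if "t \<ge> 0" for t
  proof -
    have "((\<lambda>t. f' t - 2 * c * t) has_real_derivative f'' t - 2 * c) (at t within {0..})" if "t \<ge> 0" for t
      by (rule derivative_eq_intros f'[OF that] refl)+ simp
    from mono[OF that this] show ?thesis using f'' by simp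
  qed
  moreover have "((\<lambda>t. f t - f' 0 * t - c * t\<^sup>2) has_real_derivative f' t - f' 0 - 2 * c * t)
      (at t within {0..})" if "t \<ge> 0" for t
    by (rule derivative_eq_intros f[OF that] refl)+ simp
  ultimately show ?thesis using mono[OF \<open>t \<ge> 0\<close>, of "\<lambda>t. f t - f' 0 * t - c * t\<^sup>2"] by fastforce
qed

text \<open>The geodesic equation replaces \<open>\<gamma>''\<close> by \<open>-\<Gamma>(\<gamma>', \<gamma>')\<close>, which turns the second derivative of
  \<open>|\<gamma>|\<^sup>2\<close> into the Hessian of \<open>r\<^sup>2\<close> at \<open>\<gamma>'\<close>.\<close>

lemma geodesic_norm_sq_lower_bound:
  fixes \<gamma> :: "real \<Rightarrow> real^'n::finite"
  assumes geo: "geodesic_on G {0..} \<gamma>" and unit: "unit_speed_on G {0..} \<gamma>"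
    and hess: "\<And>x X. g_hessian G (\<lambda>y. (norm y)\<^sup>2) x X X \<ge> 2 * c * (g_norm G x X)\<^sup>2"
    and "t \<ge> 0"
  shows "(norm (\<gamma> t))\<^sup>2 \<ge> (norm (\<gamma> 0))\<^sup>2 + 2 * (\<gamma> 0 \<bullet> velocity {0..} \<gamma> 0) * t + c * t\<^sup>2"
proof -
  define v where "v = velocity {0..} \<gamma>"
  define a where "a t = - christoffel_vec G (\<gamma> t) (v t) (v t)" for t
  have g1: "(\<gamma> has_vector_derivative v t) (at t within {0..})" if "t \<ge> 0" for t
    using geo that by (auto simp: geodesic_on_def v_def velocity_def vector_derivative_works)
  have g2: "(v has_vector_derivative a t) (at t within {0..})" if "t \<ge> 0" for t
  proof -
    have "vector_derivative v (at t within {0..}) = a t"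
      using geo that by (auto simp: geodesic_on_def v_def a_def eq_neg_iff_add_eq_0)
    moreover have "v differentiable (at t within {0..})"
      using geo that by (auto simp: geodesic_on_def v_def)
    ultimately show ?thesis by (metis vector_derivative_works)
  qed
  have inner': "((\<lambda>t. p t \<bullet> q t) has_real_derivative p' \<bullet> q t + p t \<bullet> q') (at t within S)"
    if "(p has_vector_derivative p') (at t within S)" "(q has_vector_derivative q') (at t within S)"
    for p q :: "real \<Rightarrow> real^'n" and p' q' t S
    using has_derivative_inner[OF that[unfolded has_vector_derivative_def]]
    by (rule has_derivative_imp_has_field_derivative) (simp add: algebra_simps)
  have "(\<gamma> 0 \<bullet> \<gamma> 0) + (2 * (\<gamma> 0 \<bullet> v 0)) * t + c * t\<^sup>2 \<le> \<gamma> t \<bullet> \<gamma> t"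
  proof (rule quadratic_lower_bound[where f' = "\<lambda>t. 2 * (\<gamma> t \<bullet> v t)"
        and f'' = "\<lambda>t. 2 * (v t \<bullet> v t + \<gamma> t \<bullet> a t)", OF _ _ _ \<open>t \<ge> 0\<close>])
    fix t :: real assume "t \<ge> 0"
    show "((\<lambda>t. \<gamma> t \<bullet> \<gamma> t) has_real_derivative 2 * (\<gamma> t \<bullet> v t)) (at t within {0..})"
      using inner'[OF g1 g1, OF \<open>t \<ge> 0\<close> \<open>t \<ge> 0\<close>] by (simp add: inner_commute)
    show "((\<lambda>t. 2 * (\<gamma> t \<bullet> v t)) has_real_derivative 2 * (v t \<bullet> v t + \<gamma> t \<bullet> a t)) (at t within {0..})"
      by (intro DERIV_cmult inner' g1 g2 \<open>t \<ge> 0\<close>)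
    have "g_norm G (\<gamma> t) (v t) = 1" using unit \<open>t \<ge> 0\<close> by (simp add: unit_speed_on_def v_def)
    then show "2 * c \<le> 2 * (v t \<bullet> v t + \<gamma> t \<bullet> a t)"
      using hess[of "\<gamma> t" "v t"] by (simp add: g_hessian_norm_sq a_def)
  qed
  then show ?thesis by (simp add: power2_norm_eq_inner v_def)
qed

text \<open>The difference of \<open>r\<^sup>2 - 2bt + \<rho>t\<^sup>2\<close> and \<open>(\<rho>t - m)\<^sup>2\<close> is
  \<open>(1 - \<rho>) t (\<rho>t - 2b) + (2\<rho>(m - b) t + r\<^sup>2 - m\<^sup>2)\<close>; the last two hypotheses are the
  nonnegativity of \<open>\<rho>t - 2b\<close> and of the second summand.\<close>

lemma escape_estimate:
  fixes N \<rho> t b m :: real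
  assumes "0 < \<rho>" "\<rho> \<le> 1" "N \<ge> 0" "t \<ge> 0"
    and N: "N\<^sup>2 \<ge> r\<^sup>2 - 2 * b * t + \<rho> * t\<^sup>2"
    and t1: "\<rho> * t \<ge> 2 * b" and t2: "2 * \<rho> * (m - b) * t \<ge> m\<^sup>2 - r\<^sup>2"
  shows "N \<ge> \<rho> * t - m"
proof -
  have "(1 - \<rho>) * (t * (\<rho> * t - 2 * b)) \<ge> 0"
    using assms by (intro mult_nonneg_nonneg) auto
  then have "(\<rho> * t - m)\<^sup>2 \<le> r\<^sup>2 - 2 * b * t + \<rho> * t\<^sup>2"
    using t2 by (simp add: power2_eq_square algebra_simps)
  with N have "(\<rho> * t - m)\<^sup>2 \<le> N\<^sup>2" by linarith
  then show ?thesis using \<open>N \<ge> 0\<close> by (rule power2_le_imp_le)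
qed

section \<open>Escape of geodesics\<close>

theorem theorem1p1:
  fixes G :: "real^'n::finite \<Rightarrow> real^'n^'n"
    and \<alpha> :: "real^'n \<Rightarrow> real"
    and r\<^sub>c \<rho>\<^sub>c \<rho>\<^sub>0 c\<^sub>0 :: real
  assumes "CARD('n) \<ge> 2"
    and "riemannian_metric G"
    and "complete_metric G"
    and "r\<^sub>c > 0"
    and "\<And>x. norm x \<ge> r\<^sub>c \<Longrightarrow> G x *v radial_vec x = radial_vec x"
    and "escape_metric G r\<^sub>c \<rho>\<^sub>c \<alpha>"
    and "0 < \<rho>\<^sub>0" and "\<rho>\<^sub>0 \<le> \<rho>\<^sub>c"
    and "\<And>x. norm x \<ge> r\<^sub>c \<Longrightarrow> norm x * \<alpha> x + 1 \<ge> \<rho>\<^sub>0"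
    and "c\<^sub>0 = (SUP x\<in>cball 0 r\<^sub>c. g_norm G x (r_grad_r G x))"
  shows "\<forall>x. \<exists>c>0. \<forall>\<gamma>.
           geodesic_on G {0..} \<gamma> \<and> unit_speed_on G {0..} \<gamma> \<and> \<gamma> 0 = x \<longrightarrow>
             (\<forall>t>c. norm (\<gamma> t) \<ge> \<rho>\<^sub>0 * t - max (norm x) c\<^sub>0) \<and>
             filterlim (\<lambda>t. norm (\<gamma> t)) at_top at_top"
proof
  fix x
  have "smooth_on UNIV G" and sym: "\<And>y. transpose (G y) = G y"
    and pos: "\<And>y X. X \<noteq> 0 \<Longrightarrow> (G y *v X) \<bullet> X > 0"
    using assms(2) by (auto simp: riemannian_metric_def)
  then have diff: "\<And>y. G differentiable (at y)"
    by (auto intro: smooth_on_UNIV_differentiable)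
  have "(G y *v X) \<bullet> X \<ge> 0" for y X using pos[of X y] by (cases "X = 0") auto
  then have g_norm_sq: "(g_norm G y X)\<^sup>2 = (G y *v X) \<bullet> X" for y X
    by (simp add: g_norm_def g_inner_def)
  have fixed: "G y *v y = y" if "norm y \<ge> r\<^sub>c" for y
  proof -
    have "y = norm y *\<^sub>R radial_vec y"
      using that \<open>r\<^sub>c > 0\<close> by (cases "y = 0") (auto simp: radial_vec_def)
    then show ?thesis using assms(5)[OF that] by (metis matrix_vector_mult_scaleR)
  qed
  have "\<rho>\<^sub>0 \<le> 1" using assms(6) \<open>\<rho>\<^sub>0 \<le> \<rho>\<^sub>c\<close> by (auto simp: escape_metric_def)

  have hess: "g_hessian G (\<lambda>y. (norm y)\<^sup>2) y X X \<ge> 2 * \<rho>\<^sub>0 * (g_norm G y X)\<^sup>2" for y X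
  proof (cases "norm y < r\<^sub>c")
    case True
    have "2 * \<rho>\<^sub>0 * (g_norm G y X)\<^sup>2 \<le> 2 * \<rho>\<^sub>c * (g_norm G y X)\<^sup>2"
      using \<open>\<rho>\<^sub>0 \<le> \<rho>\<^sub>c\<close> by (intro mult_right_mono) auto
    also have "\<dots> \<le> g_hessian G (\<lambda>y. (norm y)\<^sup>2) y X X"
      using assms(6) True by (auto simp: escape_metric_def)
    finally show ?thesis .
  next
    case False
    obtain G' where G': "(G has_derivative G') (at y)" using diff by (auto simp: differentiable_def)
    have "((1/2) *\<^sub>R radial_deriv G y *v Y) \<bullet> Y \<ge> \<alpha> y * ((G y *v Y) \<bullet> Y)" if "Y \<bullet> y = 0" for Y
      using assms(6) that False by (auto simp: escape_metric_def sphere_tangent_def g_norm_sq)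
    moreover have "y \<noteq> 0" using False \<open>r\<^sub>c > 0\<close> by auto
    ultimately show ?thesis
      unfolding g_norm_sq using False fixed assms(9)[of y] \<open>\<rho>\<^sub>0 \<le> 1\<close>
      by (intro hessian_norm_sq_ge_of_sphere_bound[OF G' sym pos, where a = "\<alpha> y"]) auto
  qed

  define b where "b = g_norm G x (r_grad_r G x)"
  have G_grad: "G x *v r_grad_r G x = x"
    using invertible_if_positive(1)[OF pos, of x] by (simp add: r_grad_r_eq matrix_vector_mul_assoc)
  have "b \<ge> 0" using g_norm_sq[of x "r_grad_r G x"] pos[of "r_grad_r G x" x]
    by (cases "r_grad_r G x = 0") (auto simp: b_def g_norm_def g_inner_def)
  \<comment> \<open>This is the Cauchy-Schwarz inequality for \<open>g\<close>, because \<open>G x\<close> sends \<open>r Dr\<close> to \<open>x\<close>.\<close>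
  have initial: "x \<bullet> v \<ge> - b" if "g_norm G x v = 1" for v
  proof (cases "b = 0")
    case True
    then have "r_grad_r G x = 0" using pos[of "r_grad_r G x" x] g_norm_sq[of x "r_grad_r G x"]
      by (auto simp: b_def)
    then show ?thesis using G_grad True by auto
  next
    case False
    let ?w = "r_grad_r G x"
    have v: "(G x *v v) \<bullet> v = 1" using that g_norm_sq[of x v] by simp
    have w: "x \<bullet> ?w = b\<^sup>2" using g_norm_sq[of x ?w] G_grad by (simp add: b_def)
    have vw: "(G x *v v) \<bullet> ?w = x \<bullet> v"
      using symmetric_matrix_inner[OF sym, of x v ?w] G_grad by (simp add: inner_commute)
    have "0 \<le> (G x *v (?w + b *\<^sub>R v)) \<bullet> (?w + b *\<^sub>R v)"
      using \<open>\<And>y X. (G y *v X) \<bullet> X \<ge> 0\<close> by blast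
    also have "\<dots> = b\<^sup>2 + 2 * b * (x \<bullet> v) + b\<^sup>2"
      by (simp add: matrix_vector_right_distrib matrix_vector_mult_scaleR inner_add_left
        inner_add_right G_grad v w vw power2_eq_square algebra_simps)
    also have "\<dots> = 2 * b * (b + x \<bullet> v)" by algebra
    finally show ?thesis using False \<open>b \<ge> 0\<close> by (simp add: zero_le_mult_iff)
  qed

  \<comment> \<open>Inside the ball \<open>m = c\<^sub>0\<close> and the inequality is strict; outside, \<open>r Dr = x\<close> and \<open>m = |x|\<close>.\<close>
  obtain m where m: "m \<le> max (norm x) c\<^sub>0" "b < m \<or> b = m \<and> m = norm x"
  proof (cases "norm x < r\<^sub>c")
    case True
    have "g_hessian G (\<lambda>y. (norm y)\<^sup>2) y X X > 0" if "X \<noteq> 0" for y X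
      using hess[of y X] pos[OF that, of y] \<open>0 < \<rho>\<^sub>0\<close>
      by (auto simp: g_norm_sq intro: less_le_trans[rotated])
    then have "b < c\<^sub>0"
      unfolding b_def assms(10) using True by (intro radial_gradient_norm_less_Sup diff sym pos) auto
    then show ?thesis by (intro that[of c\<^sub>0]) auto
  next
    case False
    then have "r_grad_r G x = x"
      using invertible_if_positive(2)[OF pos, of x] fixed[of x]
      by (metis matrix_vector_mul_assoc matrix_vector_mul_lid not_le r_grad_r_eq)
    then have "b = norm x"
      using False fixed[of x] by (simp add: b_def g_norm_def g_inner_def norm_eq_sqrt_inner)
    then show ?thesis by (intro that[of "norm x"]) auto
  qed

  \<comment> \<open>The two quotients are the times required by \<open>escape_estimate\<close>. If \<open>b = m\<close>, the second quotient is a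
     division by zero with value \<open>0\<close>, and the condition it stands for reads \<open>0 \<ge> 0\<close>.\<close>
  define c where "c = Max {1, 2 * b / \<rho>\<^sub>0, (m\<^sup>2 - (norm x)\<^sup>2) / (2 * \<rho>\<^sub>0 * (m - b))}"
  have c: "c \<ge> 1" "c \<ge> 2 * b / \<rho>\<^sub>0" "c \<ge> (m\<^sup>2 - (norm x)\<^sup>2) / (2 * \<rho>\<^sub>0 * (m - b))"
    unfolding c_def by simp_all
  show "\<exists>c>0. \<forall>\<gamma>.
           geodesic_on G {0..} \<gamma> \<and> unit_speed_on G {0..} \<gamma> \<and> \<gamma> 0 = x \<longrightarrow>
             (\<forall>t>c. norm (\<gamma> t) \<ge> \<rho>\<^sub>0 * t - max (norm x) c\<^sub>0) \<and>
             filterlim (\<lambda>t. norm (\<gamma> t)) at_top at_top"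
  proof (intro exI[of _ c] conjI allI impI)
    show "c > 0" using c(1) by simp
    fix \<gamma> assume \<gamma>: "geodesic_on G {0..} \<gamma> \<and> unit_speed_on G {0..} \<gamma> \<and> \<gamma> 0 = x"
    show bound: "norm (\<gamma> t) \<ge> \<rho>\<^sub>0 * t - max (norm x) c\<^sub>0" if "t > c" for t
    proof -
      have "t \<ge> 0" using that c(1) by simp
      let ?v = "velocity {0..} \<gamma> 0"
      have "g_norm G x ?v = 1" using \<gamma> by (auto simp: unit_speed_on_def)
      then have "x \<bullet> ?v * t \<ge> - b * t" using initial \<open>t \<ge> 0\<close> by (intro mult_right_mono) auto
      moreover have "(norm (\<gamma> t))\<^sup>2 \<ge> (norm x)\<^sup>2 + 2 * (x \<bullet> ?v) * t + \<rho>\<^sub>0 * t\<^sup>2"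
        using geodesic_norm_sq_lower_bound[OF _ _ hess \<open>t \<ge> 0\<close>, of \<gamma>] \<gamma> by auto
      ultimately have "(norm (\<gamma> t))\<^sup>2 \<ge> (norm x)\<^sup>2 - 2 * b * t + \<rho>\<^sub>0 * t\<^sup>2" by simp
      moreover have "\<rho>\<^sub>0 * t \<ge> 2 * b"
        using that c(2) \<open>0 < \<rho>\<^sub>0\<close> by (simp add: pos_divide_le_eq mult.commute)
          (smt (verit) mult_left_mono)
      moreover have "2 * \<rho>\<^sub>0 * (m - b) * t \<ge> m\<^sup>2 - (norm x)\<^sup>2"
        using m(2)
      proof
        assume "b < m"
        then have "2 * \<rho>\<^sub>0 * (m - b) > 0" using \<open>0 < \<rho>\<^sub>0\<close> by simp
        moreover have "t \<ge> (m\<^sup>2 - (norm x)\<^sup>2) / (2 * \<rho>\<^sub>0 * (m - b))" using that c(3) by simp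
        ultimately show ?thesis by (simp only: pos_divide_le_eq mult.commute)
      qed simp
      ultimately have "norm (\<gamma> t) \<ge> \<rho>\<^sub>0 * t - m"
        using \<open>0 < \<rho>\<^sub>0\<close> \<open>\<rho>\<^sub>0 \<le> 1\<close> \<open>t \<ge> 0\<close> by (intro escape_estimate[of _ _ _ "norm x" b]) auto
      then show ?thesis using m(1) by simp
    qed
    show "filterlim (\<lambda>t. norm (\<gamma> t)) at_top at_top"
    proof (rule filterlim_at_top_mono)
      show "\<forall>\<^sub>F t in at_top. \<rho>\<^sub>0 * t - max (norm x) c\<^sub>0 \<le> norm (\<gamma> t)"
        using eventually_gt_at_top[of c] by eventually_elim (rule bound)
      have "filterlim (\<lambda>t. - max (norm x) c\<^sub>0 + \<rho>\<^sub>0 * t) at_top at_top"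
        by (intro filterlim_tendsto_add_at_top[OF tendsto_const]
          filterlim_tendsto_pos_mult_at_top[OF tendsto_const \<open>0 < \<rho>\<^sub>0\<close>] filterlim_ident)
      then show "filterlim (\<lambda>t. \<rho>\<^sub>0 * t - max (norm x) c\<^sub>0) at_top at_top"
        by simp
    qed
  qed
qed

end
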